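(* In the continuous-speed model, for the Speeds&Scheduling problem on $m$ identical cores, the algorithm APX-sched is a $2^{\alpha-1}$-approximation provided that the optimal solution uses only speeds at most $s_{max}/2$; that is, under this assumption APX-sched outputs a non-preemptive schedule respecting all precedence constraints in which all tasks complete by the deadline $D$, and whose total energy is at most $2^{\alpha-1}$ times the minimum energy of any feasible solution.
   Context: Problem setting: we are given a directed acyclic graph $G=(V,E)$ whose nodes are tasks, each task $j\in V$ having weight $w_j\ge 0$, a number $m$ of identical cores, a deadline $D>0$, a constant $\alpha\ge 1$, and speed bounds $0<s_{min}\le s_{max}$. An arc $(j,k)\in E$ means $k$ cannot start before $j$ completes. Each task $j$ runs non-preemptively on one core at a single speed $s_j\in[s_{min},s_{max}]$ (any rational value), taking time $x_j=w_j/s_j$ and consuming energy $w_j s_j^{\alpha-1}=w_j^\alpha/x_j^{\alpha-1}$ (power at speed $s$ is $s^\alpha$). Speeds&Scheduling problem: choose speeds, a core for each task and start times so that tasks on the same core do not overlap, precedence constraints hold, all tasks complete by $D$, and total energy $\sum_j w_j s_j^{\alpha-1}$ is minimized. Algorithm APX-sched: (1) solve the convex program with variables $x_j,d_j$: minimize $\sum_{j\in V} w_j^\alpha/x_j^{\alpha-1}$ subject to $\sum_{j\in V}x_j/m\le D/2$; $d_j\le D/2$ for all $j$; $x_j\le d_j$ for all $j$; $d_j+x_k\le d_k$ for all $(j,k)\in E$; $w_j/s_{max}\le x_j\le w_j/s_{min}$ for all $j$; and fix the speeds $s_j=w_j/x_j$. (2) With these speeds, apply Graham's list scheduling: consider the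 tasks in a topological order of $G$ and assign each task to the core whose currently last completion time is smallest, starting it as early as possible after that time and after all its predecessors complete. (3) If the resulting makespan $C$ is smaller than $D$, lower all speeds by the factor $C/D$ (so that the makespan becomes $D$).
   Formalization: List scheduling is required to follow Graham's rule (next task is one that can start earliest among those with all predecessors placed), as an arbitrary topological order can miss the deadline; final speeds need not be at least s_min, since lowering all speeds can violate it. *)

theory Defs
  imports Complex_Main
begin

record 'a problem =
  tasks :: "'a set"
  arcs :: "('a \<times> 'a) set"
  weight :: "'a \<Rightarrow> real"
  cores :: nat
  deadline :: real
  alpha :: real
  smin :: real
  smax :: real

definition wf_problem :: "'a problem \<Rightarrow> bool" where
  "wf_problem I \<longleftrightarrow>
     finite (tasks I) \<and> arcs I \<subseteq> tasks I \<times> tasks I \<and> acyclic (arcs I) \<and>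
     (\<forall>j\<in>tasks I. 0 \<le> weight I j) \<and>
     0 < cores I \<and> 0 < deadline I \<and> 1 \<le> alpha I \<and>
     0 < smin I \<and> smin I \<le> smax I"

text \<open>A schedule gives every task a single speed, a core (a number below \<^term>\<open>cores I\<close>)
  and a start time; values outside \<^term>\<open>tasks I\<close> are irrelevant.\<close>

record 'a schedule =
  speed :: "'a \<Rightarrow> real"
  core :: "'a \<Rightarrow> nat"
  start :: "'a \<Rightarrow> real"

definition proc_time :: "'a problem \<Rightarrow> ('a \<Rightarrow> real) \<Rightarrow> 'a \<Rightarrow> real" where
  "proc_time I s j = weight I j / s j"

definition completion :: "'a problem \<Rightarrow> 'a schedule \<Rightarrow> 'a \<Rightarrow> real" where
  "completion I S j = start S j + proc_time I (speed S) j"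

definition energy :: "'a problem \<Rightarrow> 'a schedule \<Rightarrow> real" where
  "energy I S = (\<Sum>j\<in>tasks I. weight I j * speed S j powr (alpha I - 1))"

text \<open>\<open>valid_schedule\<close> does not mention the speed bounds; these are added in \<open>feasible\<close>.\<close>

definition valid_schedule :: "'a problem \<Rightarrow> 'a schedule \<Rightarrow> bool" where
  "valid_schedule I S \<longleftrightarrow>
     (\<forall>j\<in>tasks I. 0 < speed S j \<and> core S j < cores I \<and>
        0 \<le> start S j \<and> completion I S j \<le> deadline I) \<and>
     (\<forall>(j, k)\<in>arcs I. completion I S j \<le> start S k) \<and>
     (\<forall>j\<in>tasks I. \<forall>k\<in>tasks I. j \<noteq> k \<and> core S j = core S k \<longrightarrow>
        completion I S j \<le> start S k \<or> completion I S k \<le> start S j)"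

definition feasible :: "'a problem \<Rightarrow> 'a schedule \<Rightarrow> bool" where
  "feasible I S \<longleftrightarrow>
     valid_schedule I S \<and> (\<forall>j\<in>tasks I. smin I \<le> speed S j \<and> speed S j \<le> smax I)"

definition optimal :: "'a problem \<Rightarrow> 'a schedule \<Rightarrow> bool" where
  "optimal I S \<longleftrightarrow> is_arg_min (energy I) (feasible I) S"

definition cp_objective :: "'a problem \<Rightarrow> ('a \<Rightarrow> real) \<Rightarrow> real" where
  "cp_objective I x =
     (\<Sum>j\<in>tasks I. weight I j powr alpha I / x j powr (alpha I - 1))"

definition cp_feasible :: "'a problem \<Rightarrow> ('a \<Rightarrow> real) \<Rightarrow> ('a \<Rightarrow> real) \<Rightarrow> bool" where
  "cp_feasible I x d \<longleftrightarrow>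
     (\<Sum>j\<in>tasks I. x j / real (cores I)) \<le> deadline I / 2 \<and>
     (\<forall>j\<in>tasks I. d j \<le> deadline I / 2) \<and>
     (\<forall>j\<in>tasks I. x j \<le> d j) \<and>
     (\<forall>(j, k)\<in>arcs I. d j + x k \<le> d k) \<and>
     (\<forall>j\<in>tasks I. weight I j / smax I \<le> x j \<and> x j \<le> weight I j / smin I)"

definition cp_optimal :: "'a problem \<Rightarrow> ('a \<Rightarrow> real) \<Rightarrow> ('a \<Rightarrow> real) \<Rightarrow> bool" where
  "cp_optimal I x d \<longleftrightarrow>
     is_arg_min (\<lambda>(x, d). cp_objective I x) (\<lambda>(x, d). cp_feasible I x d) (x, d)"

text \<open>A task of weight 0 has \<open>x j = 0\<close>, so the quotient \<open>w / x\<close> says nothing about its speed;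
  any admissible speed may be chosen.  With Isabelle's \<open>0 / 0 = 0\<close> such a task contributes 0 to
  \<open>cp_objective\<close>, as it should.\<close>

definition cp_speeds :: "'a problem \<Rightarrow> ('a \<Rightarrow> real) \<Rightarrow> ('a \<Rightarrow> real) \<Rightarrow> bool" where
  "cp_speeds I x s \<longleftrightarrow>
     (\<forall>j\<in>tasks I. if weight I j = 0 then smin I \<le> s j \<and> s j \<le> smax I
                  else s j = weight I j / x j)"

definition topological_order :: "'a problem \<Rightarrow> 'a list \<Rightarrow> bool" where
  "topological_order I js \<longleftrightarrow>
     distinct js \<and> set js = tasks I \<and>
     (\<forall>n<length js. \<forall>k. (k, js ! n) \<in> arcs I \<longrightarrow> k \<in> set (take n js))"

text \<open>In the following, \<open>p\<close> are processing times, \<open>P\<close> is the set of tasks placed so far and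
  \<open>c\<close>, \<open>t\<close> are the cores and start times (only their values on \<open>P\<close> matter).
  \<open>core_free\<close> is the last completion time on core \<open>i\<close>; \<open>earliest_start\<close> is the start time that a
  task gets if it is placed next, that is, on a core whose last completion time is smallest.\<close>

definition core_free ::
  "('a \<Rightarrow> real) \<Rightarrow> 'a set \<Rightarrow> ('a \<Rightarrow> nat) \<Rightarrow> ('a \<Rightarrow> real) \<Rightarrow> nat \<Rightarrow> real" where
  "core_free p P c t i = Max (insert 0 ((\<lambda>k. t k + p k) ` {k \<in> P. c k = i}))"

definition earliest_start ::
  "'a problem \<Rightarrow> ('a \<Rightarrow> real) \<Rightarrow> 'a set \<Rightarrow> ('a \<Rightarrow> nat) \<Rightarrow> ('a \<Rightarrow> real) \<Rightarrow> 'a \<Rightarrow> real" where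
  "earliest_start I p P c t j =
     max (Min (core_free p P c t ` {..<cores I}))
         (Max (insert 0 ((\<lambda>k. t k + p k) ` {k. (k, j) \<in> arcs I})))"

text \<open>One pass over the tasks in the order \<open>js\<close>; ties between cores are broken arbitrarily.\<close>

definition list_schedule ::
  "'a problem \<Rightarrow> ('a \<Rightarrow> real) \<Rightarrow> 'a list \<Rightarrow> ('a \<Rightarrow> nat) \<Rightarrow> ('a \<Rightarrow> real) \<Rightarrow> bool" where
  "list_schedule I p js c t \<longleftrightarrow>
     (\<forall>n<length js. let P = set (take n js); j = js ! n in
        c j < cores I \<and>
        (\<forall>i<cores I. core_free p P c t (c j) \<le> core_free p P c t i) \<and>
        t j = earliest_start I p P c t j)"

text \<open>Graham's rule: no core is left idle while some task is ready.  In terms of a one-pass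
  procedure, the task placed next is, among those whose predecessors have all been placed, one that
  can start earliest (ties, usually resolved by a priority list, are arbitrary here).  An arbitrary
  topological order does not suffice: the pass never fills a gap left on a core that waits for a
  predecessor.  For 3 cores and the order \<open>a1, b1, b1', a2, b2, b2', \<dots>\<close>, where \<open>ai\<close> has length 1
  and precedes the very short tasks \<open>bi\<close> and \<open>bi'\<close>, it runs all \<open>ai\<close> one after the other, which
  breaks the bound (total length / number of cores + longest chain) on the makespan.\<close>

definition graham_rule ::
  "'a problem \<Rightarrow> ('a \<Rightarrow> real) \<Rightarrow> 'a list \<Rightarrow> ('a \<Rightarrow> nat) \<Rightarrow> ('a \<Rightarrow> real) \<Rightarrow> bool" where
  "graham_rule I p js c t \<longleftrightarrow>
     (\<forall>n<length js. let P = set (take n js) in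
        \<forall>k\<in>tasks I - P. (\<forall>l. (l, k) \<in> arcs I \<longrightarrow> l \<in> P) \<longrightarrow>
          earliest_start I p P c t (js ! n) \<le> earliest_start I p P c t k)"

definition graham_schedule ::
  "'a problem \<Rightarrow> ('a \<Rightarrow> real) \<Rightarrow> ('a \<Rightarrow> nat) \<Rightarrow> ('a \<Rightarrow> real) \<Rightarrow> bool" where
  "graham_schedule I p c t \<longleftrightarrow>
     (\<exists>js. topological_order I js \<and> list_schedule I p js c t \<and> graham_rule I p js c t)"

definition makespan :: "'a problem \<Rightarrow> 'a schedule \<Rightarrow> real" where
  "makespan I S = Max (insert 0 (completion I S ` tasks I))"

text \<open>Multiplying all speeds by \<open>C / D\<close> stretches the time axis by \<open>D / C\<close>.  For \<open>C = 0\<close> (all weights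
  are 0) no speed can make the makespan equal to \<open>D\<close>, and the schedule is left as it is.\<close>

definition slow_down :: "'a problem \<Rightarrow> 'a schedule \<Rightarrow> 'a schedule" where
  "slow_down I S =
     (let C = makespan I S; D = deadline I in
      if 0 < C \<and> C < D
      then \<lparr>speed = (\<lambda>j. speed S j * (C / D)), core = core S, start = (\<lambda>j. start S j * (D / C))\<rparr>
      else S)"

text \<open>\<open>apx_sched I S\<close>: \<open>S\<close> is a possible output of the algorithm on \<open>I\<close>.  It is a relation because the
  solution of the convex program and the list schedule need not be unique.\<close>

definition apx_sched :: "'a problem \<Rightarrow> 'a schedule \<Rightarrow> bool" where
  "apx_sched I S \<longleftrightarrow>
     (\<exists>x d s c t. cp_optimal I x d \<and> cp_speeds I x s \<and>
        graham_schedule I (proc_time I s) c t \<and>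
        S = slow_down I \<lparr>speed = s, core = c, start = t\<rparr>)"

end

theory Submission
  imports Defs "HOL-Analysis.Function_Topology"
begin

text \<open>Doubling the speeds of an optimal schedule halves all its times, so the result is feasible for
  the convex program, and its energy is \<open>2 powr (\<alpha> - 1)\<close> times the optimum; the bound \<open>smax / 2\<close> is
  what keeps the doubled speeds admissible.  Hence the convex optimum costs at most that much.  Under
  its speeds the average load per core and the longest chain are both at most \<open>D / 2\<close>, and Graham's
  rule yields a makespan of at most their sum \<open>D\<close>.  Slowing down only saves energy.  The convex program
  attains its minimum by compactness.\<close>

lemma core_free_empty [simp]: "core_free p {} c t i = 0"
  by (simp add: core_free_def)

lemma core_free_insert:
  assumes "finite P"
  shows "core_free p (insert j P) c t i =
           (if c j = i then max (core_free p P c t i) (t j + p j) else core_free p P c t i)"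
proof (cases "c j = i")
  case True
  then have "{k \<in> insert j P. c k = i} = insert j {k \<in> P. c k = i}"
    by auto
  with True assms show ?thesis
    by (simp add: core_free_def insert_commute[of 0 "t j + p j"] max.commute)
next
  case False
  then have "{k \<in> insert j P. c k = i} = {k \<in> P. c k = i}"
    by auto
  with False show ?thesis
    by (simp add: core_free_def)
qed

lemma core_free_ge:
  assumes "finite P" "k \<in> P"
  shows "t k + p k \<le> core_free p P c t (c k)"
  unfolding core_free_def using assms by (intro Max_ge) auto

lemma core_free_cong:
  assumes "\<And>k. k \<in> P \<Longrightarrow> c k = c' k \<and> t k = t' k"
  shows "core_free p P c t i = core_free p P c' t' i"
proof -
  have "(\<lambda>k. t k + p k) ` {k \<in> P. c k = i} = (\<lambda>k. t' k + p k) ` {k \<in> P. c' k = i}"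
    using assms by (intro image_cong) auto
  then show ?thesis by (simp add: core_free_def)
qed

lemma earliest_start_cong:
  assumes "\<And>k. k \<in> P \<Longrightarrow> c k = c' k \<and> t k = t' k"
    and "\<And>k. (k, j) \<in> arcs I \<Longrightarrow> k \<in> P"
  shows "earliest_start I p P c t j = earliest_start I p P c' t' j"
proof -
  have "(\<lambda>k. t k + p k) ` {k. (k, j) \<in> arcs I} = (\<lambda>k. t' k + p k) ` {k. (k, j) \<in> arcs I}"
    using assms by (intro image_cong) auto
  moreover have "core_free p P c t = core_free p P c' t'"
    by (intro ext core_free_cong assms(1))
  ultimately show ?thesis by (simp add: earliest_start_def)
qed

locale graham_run =
  fixes I :: "'a problem" and p :: "'a \<Rightarrow> real" and js :: "'a list"
    and c :: "'a \<Rightarrow> nat" and t :: "'a \<Rightarrow> real"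
  assumes wf: "wf_problem I"
    and time_nonneg: "\<And>j. j \<in> tasks I \<Longrightarrow> 0 \<le> p j"
    and topological: "topological_order I js"
    and list_schedule: "list_schedule I p js c t"
    and graham_rule: "graham_rule I p js c t"
begin

definition avail :: "nat \<Rightarrow> nat \<Rightarrow> real" where
  "avail n = core_free p (set (take n js)) c t"

definition ready :: "'a \<Rightarrow> real" where
  "ready j = Max (insert 0 ((\<lambda>k. t k + p k) ` {k. (k, j) \<in> arcs I}))"

lemma set_js: "set js = tasks I"
  using topological by (simp add: topological_order_def)

lemma nth_task: "n < length js \<Longrightarrow> js ! n \<in> tasks I"
  using set_js nth_mem by blast

lemma pred_placed: "n < length js \<Longrightarrow> (k, js ! n) \<in> arcs I \<Longrightarrow> k \<in> set (take n js)"
  using topological by (simp add: topological_order_def)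

lemma finite_preds: "finite {k. (k, j) \<in> arcs I}"
  by (rule finite_subset[of _ "tasks I"]) (use wf in \<open>auto simp: wf_problem_def\<close>)

lemma ready_nonneg: "0 \<le> ready j"
  by (simp add: ready_def finite_preds)

lemma ready_ge: "(k, j) \<in> arcs I \<Longrightarrow> t k + p k \<le> ready j"
  unfolding ready_def by (intro Max_ge) (auto simp: finite_preds)

lemma ready_cases:
  obtains "ready j = 0" | k where "(k, j) \<in> arcs I" "ready j = t k + p k"
proof -
  have "ready j \<in> insert 0 ((\<lambda>k. t k + p k) ` {k. (k, j) \<in> arcs I})"
    unfolding ready_def by (intro Max_in) (auto simp: finite_preds)
  then show thesis using that by auto
qed

lemma avail_Suc:
  assumes "n < length js"
  shows "avail (Suc n) i =
           (if c (js ! n) = i then max (avail n i) (t (js ! n) + p (js ! n)) else avail n i)"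
  using assms by (simp add: avail_def take_Suc_conv_app_nth core_free_insert)

lemma avail_mono: "n < length js \<Longrightarrow> avail n i \<le> avail (Suc n) i"
  by (simp add: avail_Suc)

lemma core_less: "n < length js \<Longrightarrow> c (js ! n) < cores I"
  and avail_core_le: "n < length js \<Longrightarrow> i < cores I \<Longrightarrow> avail n (c (js ! n)) \<le> avail n i"
  using list_schedule by (auto simp: list_schedule_def Let_def avail_def)

lemma earliest_start_eq:
  assumes "n < length js"
  shows "earliest_start I p (set (take n js)) c t k = max (avail n (c (js ! n))) (ready k)"
proof -
  have "Min (avail n ` {..<cores I}) = avail n (c (js ! n))"
    using assms core_less avail_core_le by (intro Min_eqI) auto
  then show ?thesis
    by (simp add: earliest_start_def avail_def ready_def)
qed

lemma start_eq:
  assumes "n < length js"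
  shows "t (js ! n) = max (avail n (c (js ! n))) (ready (js ! n))"
  using list_schedule assms earliest_start_eq[OF assms]
  by (simp add: list_schedule_def Let_def)

lemma start_le:
  assumes "n < length js" "k \<in> tasks I" "k \<notin> set (take n js)"
    and "\<And>l. (l, k) \<in> arcs I \<Longrightarrow> l \<in> set (take n js)"
  shows "t (js ! n) \<le> max (avail n (c (js ! n))) (ready k)"
proof -
  have "t (js ! n) = earliest_start I p (set (take n js)) c t (js ! n)"
    using list_schedule assms(1) by (simp add: list_schedule_def Let_def)
  also have "\<dots> \<le> earliest_start I p (set (take n js)) c t k"
    using graham_rule assms by (simp add: graham_rule_def Let_def)
  finally show ?thesis using earliest_start_eq[OF assms(1)] by simp
qed

lemma nth_notin_take: "n \<le> m \<Longrightarrow> m < length js \<Longrightarrow> js ! m \<notin> set (take n js)"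
  using topological by (auto simp: topological_order_def in_set_conv_nth nth_eq_iff_index_eq)

lemma start_Suc:
  assumes "Suc n < length js"
  shows "t (js ! n) \<le> t (js ! Suc n)"
proof (cases "(js ! n, js ! Suc n) \<in> arcs I")
  case True
  then have "t (js ! n) + p (js ! n) \<le> t (js ! Suc n)"
    using ready_ge[OF True] start_eq[OF assms] by simp
  then show ?thesis
    using time_nonneg[OF nth_task, of n] assms by simp
next
  case False
  have "l \<in> set (take n js)" if "(l, js ! Suc n) \<in> arcs I" for l
    using pred_placed[OF assms that] that False assms by (auto simp: take_Suc_conv_app_nth)
  then have "t (js ! n) \<le> max (avail n (c (js ! n))) (ready (js ! Suc n))"
    using assms nth_notin_take[of n "Suc n"] by (intro start_le) (auto intro: nth_task)
  also have "avail n (c (js ! n)) \<le> avail (Suc n) (c (js ! Suc n))"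
    using avail_core_le[of n "c (js ! Suc n)"] core_less[OF assms] avail_mono[of n] assms
    by (meson Suc_lessD order_trans)
  finally show ?thesis
    using start_eq[OF assms] by (simp add: max.coboundedI1 max.coboundedI2 split: if_splits)
qed

lemma start_mono: "n \<le> m \<Longrightarrow> m < length js \<Longrightarrow> t (js ! n) \<le> t (js ! m)"
proof (induction m rule: dec_induct)
  case (step m)
  then show ?case using start_Suc[of m] by simp
qed simp

lemma start_nonneg: "n < length js \<Longrightarrow> 0 \<le> t (js ! n)"
  using start_eq ready_nonneg by (metis max.coboundedI2)

definition work_before :: "real \<Rightarrow> 'a \<Rightarrow> real" where
  "work_before T k = max 0 (min (p k) (T - t k))"

lemma work_before_mono: "T \<le> T' \<Longrightarrow> work_before T k \<le> work_before T' k"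
  by (auto simp: work_before_def)

text \<open>From the moment a task becomes ready until it starts, no core is idle: anything started in
  between is no later than the waiting task could be, hence starts when its core becomes free.\<close>

lemma no_idle_core:
  assumes N: "N < length js" and i: "i < cores I"
    and T: "T = t (js ! N)" and r: "r = ready (js ! N)"
    and "n \<le> N"
  shows "min T (avail n i) - r \<le>
           (\<Sum>k | k \<in> set (take n js) \<and> c k = i. work_before T k - work_before r k)"
  using \<open>n \<le> N\<close>
proof (induction n)
  case 0
  then show ?case by (simp add: avail_def r ready_nonneg min.coboundedI2)
next
  case (Suc n)
  let ?j = "js ! n"
  let ?A = "\<lambda>n. {k \<in> set (take n js). c k = i}"
  let ?g = "\<lambda>k. work_before T k - work_before r k"
  have n: "n < length js" using Suc N by simp
  have "r \<le> T" using start_eq[OF N] by (simp add: T r)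
  then have g: "0 \<le> ?g k" for k by (simp add: work_before_mono)
  have IH: "min T (avail n i) - r \<le> sum ?g (?A n)" using Suc by simp
  show ?case
  proof (cases "c ?j = i")
    case False
    then have "?A (Suc n) = ?A n"
      using n by (auto simp: take_Suc_conv_app_nth)
    with IH False n show ?thesis by (simp add: avail_Suc)
  next
    case True
    then have "?A (Suc n) = insert ?j (?A n)"
      using n by (auto simp: take_Suc_conv_app_nth)
    then have sum: "sum ?g (?A (Suc n)) = ?g ?j + sum ?g (?A n)"
      using nth_notin_take[of n n] n by simp
    have p: "0 \<le> p ?j" using time_nonneg nth_task n by simp
    have start: "avail n i \<le> t ?j" using start_eq[OF n] True by simp
    then have avail: "avail (Suc n) i = t ?j + p ?j"
      using p True n by (simp add: avail_Suc)
    show ?thesis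
    proof (cases "t ?j \<le> r")
      case True
      then have "min T (t ?j + p ?j) - r \<le> ?g ?j"
        using p \<open>r \<le> T\<close> by (auto simp: work_before_def)
      moreover have "0 \<le> sum ?g (?A n)" by (intro sum_nonneg g)
      ultimately show ?thesis unfolding avail sum by linarith
    next
      case False
      have "l \<in> set (take n js)" if l: "(l, js ! N) \<in> arcs I" for l
      proof -
        obtain q where q: "q < N" "l = js ! q"
          using pred_placed[OF N l] by (auto simp: in_set_conv_nth)
        have "t l + p l \<le> r" using ready_ge[OF l] r by simp
        then have "t l < t ?j"
          using False time_nonneg[of l] nth_task[of q] q N by simp
        then have "q < n"
          using start_mono[of n q] q N by (meson leD leI less_trans)
        then show ?thesis using q n by (auto simp: in_set_conv_nth)
      qed
      then have "t ?j \<le> max (avail n i) r"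
        using start_le[OF n, of "js ! N"] Suc.prems N True
        by (auto simp: r nth_task nth_notin_take)
      then have "t ?j = avail n i" using False start by simp
      moreover have "t ?j \<le> T" using start_mono[of n N] Suc.prems N T by simp
      moreover have "min T (t ?j + p ?j) - t ?j \<le> ?g ?j"
        using p False \<open>t ?j \<le> T\<close> by (auto simp: work_before_def)
      ultimately show ?thesis using IH unfolding avail sum by simp
    qed
  qed
qed

lemma busy_while_waiting:
  assumes N: "N < length js"
  shows "real (cores I) * (t (js ! N) - ready (js ! N)) \<le>
           (\<Sum>k\<in>tasks I. work_before (t (js ! N)) k) - (\<Sum>k\<in>tasks I. work_before (ready (js ! N)) k)"
proof -
  let ?T = "t (js ! N)" and ?r = "ready (js ! N)"
  let ?g = "\<lambda>k. work_before ?T k - work_before ?r k"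
  let ?P = "set (take N js)"
  have "?r \<le> ?T" using start_eq[OF N] by simp
  then have g: "0 \<le> ?g k" for k by (simp add: work_before_mono)
  have fin: "finite (tasks I)" using wf by (simp add: wf_problem_def)
  have P: "?P \<subseteq> tasks I" using set_js set_take_subset by fast
  have "real (cores I) * (?T - ?r) \<le> sum ?g (tasks I)"
  proof (cases "?T = ?r")
    case True
    then show ?thesis by simp
  next
    case False
    then have T: "?T = avail N (c (js ! N))"
      using start_eq[OF N] by (auto simp: max_def split: if_splits)
    have "?T - ?r \<le> (\<Sum>k | k \<in> ?P \<and> c k = i. ?g k)" if "i < cores I" for i
      using no_idle_core[OF N that refl refl order_refl] avail_core_le[OF N that] T by simp
    then have "(\<Sum>i<cores I. ?T - ?r) \<le> (\<Sum>i<cores I. \<Sum>k | k \<in> ?P \<and> c k = i. ?g k)"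
      by (intro sum_mono) simp
    also have "\<dots> = sum ?g ?P"
      using core_less N by (intro sum.group) (auto simp: in_set_conv_nth)
    also have "\<dots> \<le> sum ?g (tasks I)"
      using fin P g by (intro sum_mono2) auto
    finally show ?thesis by simp
  qed
  then show ?thesis by (simp add: sum_subtractf)
qed

text \<open>Follow a chain of predecessors backwards from a task, always to the one that finishes last:
  the time before the task starts is covered by the chain, of total length at most \<open>d j - p j\<close>, and
  by waiting periods, in which all cores work.\<close>

lemma start_bound:
  assumes "\<And>j. j \<in> tasks I \<Longrightarrow> p j \<le> d j"
    and "\<And>j k. (j, k) \<in> arcs I \<Longrightarrow> d j + p k \<le> d k"
    and "n < length js"
  shows "real (cores I) * t (js ! n) \<le>
           (\<Sum>k\<in>tasks I. work_before (t (js ! n)) k) + real (cores I) * (d (js ! n) - p (js ! n))"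
  using assms(3)
proof (induction n rule: less_induct)
  case (less n)
  let ?B = "\<lambda>T. \<Sum>k\<in>tasks I. work_before T k" and ?j = "js ! n" and ?m = "real (cores I)"
  have busy: "?m * (t ?j - ready ?j) \<le> ?B (t ?j) - ?B (ready ?j)"
    using busy_while_waiting less.prems .
  show ?case
  proof (cases rule: ready_cases[of ?j])
    case 1
    have "0 \<le> ?B 0" by (intro sum_nonneg) (simp add: work_before_def)
    moreover have "0 \<le> ?m * (d ?j - p ?j)"
      using assms(1)[OF nth_task[OF less.prems]] by simp
    ultimately show ?thesis using busy 1 by simp
  next
    case (2 k)
    obtain q where q: "q < n" "k = js ! q"
      using pred_placed[OF less.prems 2(1)] by (auto simp: in_set_conv_nth)
    have "t k \<le> ready ?j"
      using 2 q time_nonneg[of k] nth_task[of q] less.prems by simp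
    then have "?B (t k) \<le> ?B (ready ?j)" by (intro sum_mono work_before_mono)
    moreover have "?m * t k \<le> ?B (t k) + ?m * (d k - p k)"
      using less.IH[of q] q less.prems by simp
    moreover have "?m * (d k + p ?j) \<le> ?m * d ?j"
      using assms(2)[OF 2(1)] by (intro mult_left_mono) auto
    ultimately show ?thesis using busy 2(2) by (simp add: algebra_simps)
  qed
qed

lemma completion_bound:
  assumes "\<And>j. j \<in> tasks I \<Longrightarrow> p j \<le> d j"
    and "\<And>j k. (j, k) \<in> arcs I \<Longrightarrow> d j + p k \<le> d k"
    and "j \<in> tasks I"
  shows "t j + p j \<le> (\<Sum>k\<in>tasks I. p k / real (cores I)) + d j"
proof -
  obtain n where n: "n < length js" "j = js ! n"
    using assms(3) set_js by (metis in_set_conv_nth)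
  have m: "0 < real (cores I)" using wf by (simp add: wf_problem_def)
  have "(\<Sum>k\<in>tasks I. work_before (t j) k) \<le> (\<Sum>k\<in>tasks I. p k)"
    by (intro sum_mono) (simp add: work_before_def time_nonneg)
  then have "real (cores I) * t j \<le> (\<Sum>k\<in>tasks I. p k) + real (cores I) * (d j - p j)"
    using start_bound[OF assms(1,2) n(1)] n(2) by force
  then show ?thesis
    using m by (simp add: field_simps flip: sum_divide_distrib)
qed

lemma same_core_separated:
  assumes "a < b" "b < length js" "c (js ! a) = c (js ! b)"
  shows "t (js ! a) + p (js ! a) \<le> t (js ! b)"
proof -
  have "js ! a \<in> set (take b js)"
    using assms by (auto simp: in_set_conv_nth)
  then have "t (js ! a) + p (js ! a) \<le> avail b (c (js ! a))"
    unfolding avail_def by (intro core_free_ge) auto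
  then show ?thesis using start_eq[OF assms(2)] assms(3) by simp
qed

lemma valid_scheduleI:
  assumes "\<And>j. j \<in> tasks I \<Longrightarrow> p j = proc_time I s j"
    and "\<And>j. j \<in> tasks I \<Longrightarrow> 0 < s j"
    and "\<And>j. j \<in> tasks I \<Longrightarrow> t j + p j \<le> deadline I"
  shows "valid_schedule I \<lparr>speed = s, core = c, start = t\<rparr>"
proof -
  let ?S = "\<lparr>speed = s, core = c, start = t\<rparr>"
  have compl: "completion I ?S j = t j + p j" if "j \<in> tasks I" for j
    using assms(1) that by (simp add: completion_def)
  have idx: "\<exists>n<length js. j = js ! n" if "j \<in> tasks I" for j
    using that set_js by (metis in_set_conv_nth)
  have arcs: "arcs I \<subseteq> tasks I \<times> tasks I" using wf by (simp add: wf_problem_def)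
  have "c j < cores I \<and> 0 \<le> t j" if "j \<in> tasks I" for j
    using idx[OF that] core_less start_nonneg by blast
  moreover have "t j + p j \<le> t k" if jk: "(j, k) \<in> arcs I" for j k
  proof -
    obtain n where "n < length js" "k = js ! n" using idx[of k] jk arcs by blast
    then show ?thesis using start_eq ready_ge[OF jk] by (metis max.coboundedI2)
  qed
  moreover have "t j + p j \<le> t k \<or> t k + p k \<le> t j"
    if jk: "j \<in> tasks I" "k \<in> tasks I" "j \<noteq> k" "c j = c k" for j k
  proof -
    obtain a b where "a < length js" "j = js ! a" "b < length js" "k = js ! b"
      using idx jk by meson
    then show ?thesis
      using same_core_separated[of a b] same_core_separated[of b a] jk(3,4)
      by (metis linorder_neqE_nat)
  qed
  ultimately show ?thesis
    using assms(2,3) compl arcs by (auto simp: valid_schedule_def)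
qed

end

lemma separated_intervals_length:
  fixes a b :: "'a \<Rightarrow> real"
  assumes "finite A" "0 \<le> D"
    and "\<And>j. j \<in> A \<Longrightarrow> 0 \<le> a j \<and> a j \<le> b j \<and> b j \<le> D"
    and "\<And>j k. j \<in> A \<Longrightarrow> k \<in> A \<Longrightarrow> j \<noteq> k \<Longrightarrow> b j \<le> a k \<or> b k \<le> a j"
  shows "(\<Sum>j\<in>A. b j - a j) \<le> D"
  using assms
proof (induction "card A" arbitrary: A D)
  case 0
  then show ?case by simp
next
  case (Suc n)
  show ?case
  proof (cases "\<exists>j\<in>A. a j = b j")
    case True
    then obtain j where j: "j \<in> A" "a j = b j" by blast
    have "(\<Sum>k\<in>A - {j}. b k - a k) \<le> D"
      using Suc j by (intro Suc.hyps(1)) auto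
    then show ?thesis using j Suc.prems(1) by (simp add: sum.remove)
  next
    case False
    have "A \<noteq> {}" using Suc.hyps(2) by auto
    then have "Max (a ` A) \<in> a ` A" using Suc.prems(1) by (intro Max_in) auto
    then obtain j where "j \<in> A" "a j = Max (a ` A)" by auto
    then have j: "j \<in> A" "\<And>k. k \<in> A \<Longrightarrow> a k \<le> a j"
      using Suc.prems(1) by simp_all
    have "b k \<le> a j" if "k \<in> A - {j}" for k
      using Suc.prems(3)[of j] Suc.prems(4)[of j k] j that False by force
    then have "(\<Sum>k\<in>A - {j}. b k - a k) \<le> a j"
      using Suc.hyps(2) Suc.prems j by (intro Suc.hyps(1)) auto
    then show ?thesis using j Suc.prems(1) Suc.prems(3)[of j] by (simp add: sum.remove)
  qed
qed
definition partial_run ::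
  "'a problem \<Rightarrow> ('a \<Rightarrow> real) \<Rightarrow> 'a list \<Rightarrow> ('a \<Rightarrow> nat) \<Rightarrow> ('a \<Rightarrow> real) \<Rightarrow> bool" where
  "partial_run I p js c t \<longleftrightarrow>
     distinct js \<and> set js \<subseteq> tasks I \<and>
     (\<forall>n<length js. \<forall>k. (k, js ! n) \<in> arcs I \<longrightarrow> k \<in> set (take n js)) \<and>
     list_schedule I p js c t \<and> graham_rule I p js c t"

lemma ex_ready_task:
  assumes wf: "wf_problem I" and "P \<subset> tasks I"
  shows "\<exists>k\<in>tasks I - P. \<forall>l. (l, k) \<in> arcs I \<longrightarrow> l \<in> P"
proof -
  have "finite (arcs I)"
    using wf finite_subset[of "arcs I" "tasks I \<times> tasks I"] by (simp add: wf_problem_def)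
  then have "wf (arcs I)"
    using wf by (simp add: wf_problem_def finite_acyclic_wf)
  moreover obtain x where "x \<in> tasks I - P" using assms(2) by blast
  ultimately obtain k where "k \<in> tasks I - P" "\<And>l. (l, k) \<in> arcs I \<Longrightarrow> l \<notin> tasks I - P"
    by (rule wfE_min) blast
  then show ?thesis using wf by (auto simp: wf_problem_def)
qed

lemma partial_run_extend:
  assumes wf: "wf_problem I" and run: "partial_run I p js c t" and "set js \<subset> tasks I"
  shows "\<exists>j c' t'. partial_run I p (js @ [j]) c' t'"
proof -
  let ?P = "set js"
  define R where "R = {k \<in> tasks I - ?P. \<forall>l. (l, k) \<in> arcs I \<longrightarrow> l \<in> ?P}"
  have "finite R" using wf by (simp add: R_def wf_problem_def)
  moreover have "R \<noteq> {}" using ex_ready_task[OF wf assms(3)] by (auto simp: R_def)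
  ultimately obtain j where j: "j \<in> R"
      "\<And>k. k \<in> R \<Longrightarrow> earliest_start I p ?P c t j \<le> earliest_start I p ?P c t k"
    using arg_min_if_finite[of R "earliest_start I p ?P c t"] by (metis leI)
  have "{..<cores I} \<noteq> {}" using wf by (auto simp: wf_problem_def)
  then obtain i where i: "i < cores I"
      "\<And>i'. i' < cores I \<Longrightarrow> core_free p ?P c t i \<le> core_free p ?P c t i'"
    using arg_min_if_finite[of "{..<cores I}" "core_free p ?P c t"]
    by (metis finite_lessThan leI lessThan_iff)
  define c' where "c' = c(j := i)"
  define t' where "t' = t(j := earliest_start I p ?P c t j)"
  have j': "j \<notin> ?P" "j \<in> tasks I" "\<And>l. (l, j) \<in> arcs I \<Longrightarrow> l \<in> ?P"
    using j(1) by (auto simp: R_def)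
  have own: "c' j = i" "t' j = earliest_start I p ?P c t j"
    by (simp_all add: c'_def t'_def)
  have agree: "c k = c' k \<and> t k = t' k" if "k \<in> set (take n js)" for k n
    using that j'(1) set_take_subset[of n js] by (auto simp: c'_def t'_def)
  have free: "core_free p (set (take n js)) c' t' = core_free p (set (take n js)) c t" for n
    by (intro ext core_free_cong[symmetric] agree)
  have est: "earliest_start I p (set (take n js)) c' t' k = earliest_start I p (set (take n js)) c t k"
    if "\<And>l. (l, k) \<in> arcs I \<Longrightarrow> l \<in> set (take n js)" for n k
    using earliest_start_cong[OF agree that] by simp
  have free_all: "core_free p ?P c' t' = core_free p ?P c t"
    using free[of "length js"] by simp
  have est_all: "earliest_start I p ?P c' t' k = earliest_start I p ?P c t k"
    if "\<And>l. (l, k) \<in> arcs I \<Longrightarrow> l \<in> ?P" for k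
    using est[of k "length js"] that by simp
  have pred: "k \<in> set (take n js)" if "n < length js" "(k, js ! n) \<in> arcs I" for n k
    using run that by (simp add: partial_run_def)
  have ne: "js ! n \<noteq> j" if "n < length js" for n
    using j'(1) that nth_mem by blast
  have "list_schedule I p (js @ [j]) c' t'"
    unfolding list_schedule_def Let_def
  proof (intro allI impI)
    fix n assume n: "n < length (js @ [j])"
    show "c' ((js @ [j]) ! n) < cores I \<and>
      (\<forall>i<cores I. core_free p (set (take n (js @ [j]))) c' t' (c' ((js @ [j]) ! n))
         \<le> core_free p (set (take n (js @ [j]))) c' t' i) \<and>
      t' ((js @ [j]) ! n) = earliest_start I p (set (take n (js @ [j]))) c' t' ((js @ [j]) ! n)"
    proof (cases "n < length js")
      case True
      have "c' (js ! n) = c (js ! n)" "t' (js ! n) = t (js ! n)"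
        using ne[OF True] by (simp_all add: c'_def t'_def)
      then show ?thesis
        using True run est[of "js ! n" n] pred[OF True]
        by (simp add: nth_append free partial_run_def list_schedule_def Let_def)
    next
      case False
      then have "n = length js" using n by simp
      then show ?thesis
        using i est_all[of j] j'(3) own by (simp add: free_all)
    qed
  qed
  moreover have "graham_rule I p (js @ [j]) c' t'"
    unfolding graham_rule_def Let_def
  proof (intro allI impI ballI)
    fix n k
    assume n: "n < length (js @ [j])" and k: "k \<in> tasks I - set (take n (js @ [j]))"
      "\<forall>l. (l, k) \<in> arcs I \<longrightarrow> l \<in> set (take n (js @ [j]))"
    show "earliest_start I p (set (take n (js @ [j]))) c' t' ((js @ [j]) ! n)
      \<le> earliest_start I p (set (take n (js @ [j]))) c' t' k"
    proof (cases "n < length js")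
      case True
      then show ?thesis
        using k run est[of "js ! n" n] est[of k n] pred[OF True]
        by (simp add: nth_append partial_run_def graham_rule_def Let_def)
    next
      case False
      then have "n = length js" using n by simp
      then show ?thesis
        using k j(2)[of k] est_all[of j] est_all[of k] j'(3) by (simp add: R_def)
    qed
  qed
  moreover have "(js @ [j]) ! n = j" if "n < length (js @ [j])" "\<not> n < length js" for n
    using that by (simp add: nth_append)
  then have "k \<in> set (take n (js @ [j]))"
    if "n < length (js @ [j])" "(k, (js @ [j]) ! n) \<in> arcs I" for n k
    using that pred[of n k] j'(3)[of k] by (cases "n < length js") (auto simp: nth_append)
  ultimately have "partial_run I p (js @ [j]) c' t'"
    using run j' by (auto simp: partial_run_def)
  then show ?thesis by blast
qed

lemma graham_schedule_exists:
  assumes wf: "wf_problem I"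
  shows "\<exists>c t. graham_schedule I p c t"
proof -
  have fin: "finite (tasks I)" using wf by (simp add: wf_problem_def)
  have "\<exists>js c t. length js = n \<and> partial_run I p js c t" if "n \<le> card (tasks I)" for n
    using that
  proof (induction n)
    case 0
    then show ?case by (simp add: partial_run_def list_schedule_def graham_rule_def)
  next
    case (Suc n)
    then obtain js c t where js: "length js = n" "partial_run I p js c t" by auto
    then have "set js \<subseteq> tasks I" "card (set js) = n"
      by (auto simp: partial_run_def distinct_card)
    with Suc.prems have "set js \<subset> tasks I" by auto
    then show ?case using partial_run_extend[OF wf js(2)] js(1)
      by (metis length_append_singleton)
  qed
  then obtain js c t where js: "length js = card (tasks I)" "partial_run I p js c t" by blast
  then have "set js = tasks I"
    using fin by (intro card_subset_eq) (auto simp: partial_run_def distinct_card)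
  then show ?thesis
    using js(2) by (auto simp: partial_run_def graham_schedule_def topological_order_def)
qed

lemma compact_PiE_real:
  fixes K :: "'a \<Rightarrow> real set"
  assumes "\<And>j. j \<in> A \<Longrightarrow> compact (K j)"
  shows "compact (PiE A K)"
proof -
  have "PiE A K = PiE UNIV (\<lambda>j. if j \<in> A then K j else {undefined})"
    by (auto simp: PiE_def extensional_def Pi_def split: if_splits)
  then have "compactin (product_topology (\<lambda>_. euclidean) UNIV) (PiE A K)"
    using assms by (simp add: compactin_PiE)
  then show ?thesis by (simp add: euclidean_product_topology)
qed

lemma cp_optimal_exists:
  assumes wf: "wf_problem I" and feas: "cp_feasible I x0 d0"
  shows "\<exists>x d. cp_optimal I x d"
proof -
  let ?V = "tasks I"
  define K where "K = PiE ?V (\<lambda>j. {weight I j / smax I..weight I j / smin I})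
    \<times> PiE ?V (\<lambda>_. {0..deadline I / 2})"
  define F where "F = {(x, d). cp_feasible I x d}"
  have arcs: "arcs I \<subseteq> ?V \<times> ?V" and w: "\<And>j. j \<in> ?V \<Longrightarrow> 0 \<le> weight I j"
    and s: "0 < smin I" "0 < smax I"
    using wf by (auto simp: wf_problem_def)
  have restrict: "(restrict x ?V, restrict d ?V) \<in> K \<inter> F" if "cp_feasible I x d" for x d
  proof -
    have "0 \<le> d j" if "j \<in> ?V" for j
      using \<open>cp_feasible I x d\<close> w[OF that] s(2) that
      by (meson cp_feasible_def divide_nonneg_pos order_trans)
    then show ?thesis
      using that arcs by (auto simp: K_def F_def cp_feasible_def)
  qed
  have fst: "continuous_on S (\<lambda>z. fst z j)" and snd: "continuous_on S (\<lambda>z. snd z j)"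
    for S :: "(('a \<Rightarrow> real) \<times> ('a \<Rightarrow> real)) set" and j
    by (rule continuous_on_product_then_coordinatewise[OF continuous_on_fst[OF continuous_on_id]]
        continuous_on_product_then_coordinatewise[OF continuous_on_snd[OF continuous_on_id]])+
  have "closed F"
    unfolding F_def cp_feasible_def case_prod_unfold Ball_def
    by (intro closed_Collect_conj closed_Collect_all closed_Collect_imp closed_Collect_le
        open_Collect_const fst snd continuous_intros) (use wf in \<open>auto simp: wf_problem_def\<close>)
  moreover have "compact K"
    unfolding K_def by (intro compact_Times compact_PiE_real compact_Icc)
  ultimately have "compact (K \<inter> F)" by (simp add: compact_Int_closed)
  moreover have "K \<inter> F \<noteq> {}" using restrict[OF feas] by blast
  moreover have "continuous_on (K \<inter> F) (\<lambda>z. cp_objective I (fst z))"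
    unfolding cp_objective_def
  proof (intro continuous_on_sum)
    fix j assume j: "j \<in> ?V"
    show "continuous_on (K \<inter> F) (\<lambda>z. weight I j powr alpha I / fst z j powr (alpha I - 1))"
    proof (cases "weight I j = 0")
      case False
      then have "0 < weight I j / smax I" using w[OF j] s by simp
      moreover have "weight I j / smax I \<le> fst z j" if "z \<in> K" for z
        using that j by (auto simp: K_def)
      ultimately have "0 < fst z j" if "z \<in> K \<inter> F" for z
        using that by fastforce
      then show ?thesis by (intro fst continuous_intros) force+
    qed simp
  qed
  ultimately obtain z where z: "z \<in> K \<inter> F"
      "\<And>z'. z' \<in> K \<inter> F \<Longrightarrow> cp_objective I (fst z) \<le> cp_objective I (fst z')"
    by (metis continuous_attains_inf)
  have "cp_objective I (fst z) \<le> cp_objective I x" if "cp_feasible I x d" for x d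
    using z(2)[OF restrict[OF that]] by (simp add: cp_objective_def)
  then have "cp_optimal I (fst z) (snd z)"
    using z(1) by (auto simp: cp_optimal_def is_arg_min_linorder F_def)
  then show ?thesis by blast
qed

lemma total_proc_time_le:
  assumes wf: "wf_problem I" and valid: "valid_schedule I S"
  shows "(\<Sum>j\<in>tasks I. proc_time I (speed S) j) \<le> real (cores I) * deadline I"
proof -
  let ?V = "tasks I" and ?p = "proc_time I (speed S)"
  have fin: "finite ?V" using wf by (simp add: wf_problem_def)
  have "(\<Sum>j | j \<in> ?V \<and> core S j = i. ?p j) \<le> deadline I" for i
  proof -
    have "0 \<le> ?p j" if "j \<in> ?V" for j
      using wf valid that by (auto simp: proc_time_def wf_problem_def valid_schedule_def less_imp_le)
    then have "(\<Sum>j | j \<in> ?V \<and> core S j = i. completion I S j - start S j) \<le> deadline I"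
      using wf valid fin
      by (intro separated_intervals_length)
        (auto simp: valid_schedule_def wf_problem_def completion_def)
    then show ?thesis by (simp add: completion_def)
  qed
  then have "(\<Sum>i<cores I. \<Sum>j | j \<in> ?V \<and> core S j = i. ?p j) \<le> (\<Sum>i<cores I. deadline I)"
    by (intro sum_mono)
  moreover have "(\<Sum>i<cores I. \<Sum>j | j \<in> ?V \<and> core S j = i. ?p j) = sum ?p ?V"
    using fin valid by (intro sum.group) (auto simp: valid_schedule_def)
  ultimately show ?thesis by simp
qed

lemma energy_term_eq:
  fixes w x a :: real
  assumes "0 < w" "0 < x"
  shows "w powr a / x powr (a - 1) = w * (w / x) powr (a - 1)"
proof -
  have "w powr a = w * w powr (a - 1)"
    using assms by (simp add: powr_diff)
  then show ?thesis using assms by (simp add: powr_divide)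
qed

lemma cp_feasible_half:
  assumes wf: "wf_problem I" and feas: "feasible I S"
    and fast: "\<forall>j\<in>tasks I. speed S j \<le> smax I / 2"
  shows "cp_feasible I (\<lambda>j. proc_time I (speed S) j / 2) (\<lambda>j. completion I S j / 2)"
proof -
  let ?p = "proc_time I (speed S)"
  have valid: "valid_schedule I S" using feas by (simp add: feasible_def)
  have arcs: "arcs I \<subseteq> tasks I \<times> tasks I" and m: "0 < cores I" and smin: "0 < smin I"
    using wf by (auto simp: wf_problem_def)
  have "(\<Sum>j\<in>tasks I. ?p j / 2 / real (cores I)) = sum ?p (tasks I) / (2 * real (cores I))"
    by (simp add: sum_divide_distrib)
  also have "\<dots> \<le> deadline I / 2"
    using total_proc_time_le[OF wf valid] m by (simp add: field_simps)
  finally have "(\<Sum>j\<in>tasks I. ?p j / 2 / real (cores I)) \<le> deadline I / 2" .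
  moreover have "weight I j / smax I \<le> ?p j / 2 \<and> ?p j / 2 \<le> weight I j / smin I"
    if "j \<in> tasks I" for j
  proof -
    have w: "0 \<le> weight I j" and "0 < speed S j" "smin I \<le> 2 * speed S j" "2 * speed S j \<le> smax I"
      using wf valid feas fast that smin
      by (fastforce simp: wf_problem_def valid_schedule_def feasible_def)+
    then have "weight I j / smax I \<le> weight I j / (2 * speed S j)"
      "weight I j / (2 * speed S j) \<le> weight I j / smin I"
      using smin by (auto intro!: divide_left_mono)
    then show ?thesis by (simp add: proc_time_def mult.commute)
  qed
  moreover have "completion I S j / 2 + ?p k / 2 \<le> completion I S k / 2" if "(j, k) \<in> arcs I" for j k
    using valid that by (auto simp: valid_schedule_def completion_def)
  moreover have "completion I S j / 2 \<le> deadline I / 2 \<and> ?p j / 2 \<le> completion I S j / 2"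
    if "j \<in> tasks I" for j
    using valid that by (simp add: valid_schedule_def) (simp add: completion_def)
  ultimately show ?thesis by (auto simp: cp_feasible_def)
qed

lemma cp_objective_half:
  assumes wf: "wf_problem I" and valid: "valid_schedule I S"
  shows "cp_objective I (\<lambda>j. proc_time I (speed S) j / 2) = 2 powr (alpha I - 1) * energy I S"
  unfolding cp_objective_def energy_def sum_distrib_left
proof (intro sum.cong refl)
  fix j assume j: "j \<in> tasks I"
  have s: "0 < speed S j" and w: "0 \<le> weight I j"
    using wf valid j by (auto simp: wf_problem_def valid_schedule_def)
  show "weight I j powr alpha I / (proc_time I (speed S) j / 2) powr (alpha I - 1) =
    2 powr (alpha I - 1) * (weight I j * speed S j powr (alpha I - 1))"
  proof (cases "weight I j = 0")
    case False
    then have w: "0 < weight I j" using w by simp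
    then have "weight I j / (proc_time I (speed S) j / 2) = 2 * speed S j"
      using s by (simp add: proc_time_def)
    then show ?thesis
      using energy_term_eq[OF w, of "proc_time I (speed S) j / 2" "alpha I"] s w
      by (simp add: powr_mult proc_time_def)
  qed simp
qed

lemma cp_speeds_properties:
  assumes wf: "wf_problem I" and feas: "cp_feasible I x d" and speeds: "cp_speeds I x s"
    and j: "j \<in> tasks I"
  shows "0 < s j" "s j \<le> smax I" "proc_time I s j = x j"
    and "weight I j * s j powr (alpha I - 1) = weight I j powr alpha I / x j powr (alpha I - 1)"
proof -
  have b: "weight I j / smax I \<le> x j" "x j \<le> weight I j / smin I" "0 \<le> weight I j"
    "0 < smin I" "0 < smax I"
    using wf feas j by (auto simp: wf_problem_def cp_feasible_def)
  have "0 < s j \<and> s j \<le> smax I \<and> proc_time I s j = x j \<and>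
    weight I j * s j powr (alpha I - 1) = weight I j powr alpha I / x j powr (alpha I - 1)"
  proof (cases "weight I j = 0")
    case True
    then show ?thesis using b speeds j by (auto simp: cp_speeds_def proc_time_def)
  next
    case False
    then have w: "0 < weight I j" using b by simp
    then have "0 < weight I j / smax I" using b by simp
    then have x: "0 < x j" using b by linarith
    have "s j = weight I j / x j" using speeds j False by (simp add: cp_speeds_def)
    moreover have "weight I j / x j \<le> smax I" using w x b by (simp add: field_simps)
    ultimately show ?thesis
      using w x energy_term_eq[OF w x] by (simp add: proc_time_def)
  qed
  then show "0 < s j" "s j \<le> smax I" "proc_time I s j = x j"
    and "weight I j * s j powr (alpha I - 1) = weight I j powr alpha I / x j powr (alpha I - 1)"
    by auto
qed

lemma slow_down_properties:
  assumes wf: "wf_problem I" and valid: "valid_schedule I S"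
  shows "valid_schedule I (slow_down I S)"
    and "\<And>j. j \<in> tasks I \<Longrightarrow> speed (slow_down I S) j \<le> speed S j"
    and "energy I (slow_down I S) \<le> energy I S"
proof -
  let ?C = "makespan I S" and ?D = "deadline I"
  have fin: "finite (tasks I)" using wf by (simp add: wf_problem_def)
  have arcs: "arcs I \<subseteq> tasks I \<times> tasks I" using wf by (simp add: wf_problem_def)
  have C: "completion I S j \<le> ?C" if "j \<in> tasks I" for j
    unfolding makespan_def using fin that by (intro Max_ge) auto
  have "valid_schedule I (slow_down I S) \<and>
    (\<forall>j\<in>tasks I. 0 < speed (slow_down I S) j \<and> speed (slow_down I S) j \<le> speed S j)"
  proof (cases "0 < ?C \<and> ?C < ?D")
    case False
    then have "slow_down I S = S" by (auto simp: slow_down_def Let_def)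
    then show ?thesis using valid by (simp add: valid_schedule_def)
  next
    case True
    then have S': "slow_down I S = \<lparr>speed = (\<lambda>j. speed S j * (?C / ?D)), core = core S,
        start = (\<lambda>j. start S j * (?D / ?C))\<rparr>" (is "_ = ?S'")
      by (simp add: slow_down_def Let_def)
    have compl: "completion I ?S' j = completion I S j * (?D / ?C)" for j
      using True by (simp add: completion_def proc_time_def field_simps)
    have mono: "a * (?D / ?C) \<le> b * (?D / ?C)" if "a \<le> b" for a b
      using that True by (intro mult_right_mono) auto
    have "completion I S j * (?D / ?C) \<le> ?D" if "j \<in> tasks I" for j
      using mono[OF C[OF that]] True by simp
    moreover have "0 < speed S j * (?C / ?D)" "0 \<le> start S j * (?D / ?C)"
      if "j \<in> tasks I" for j
      using that True valid by (auto simp: valid_schedule_def)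
    moreover have "speed S j * (?C / ?D) \<le> speed S j" if "j \<in> tasks I" for j
      using that True valid by (intro mult_left_le) (auto simp: valid_schedule_def less_imp_le)
    moreover have "completion I S j * (?D / ?C) \<le> start S k * (?D / ?C)" if "(j, k) \<in> arcs I" for j k
      using valid that by (intro mono) (auto simp: valid_schedule_def)
    moreover have "completion I S j * (?D / ?C) \<le> start S k * (?D / ?C) \<or>
        completion I S k * (?D / ?C) \<le> start S j * (?D / ?C)"
      if "j \<in> tasks I" "k \<in> tasks I" "j \<noteq> k" "core S j = core S k" for j k
      using valid that mono unfolding valid_schedule_def by meson
    ultimately show ?thesis
      using valid unfolding S' valid_schedule_def compl by auto
  qed
  then show "valid_schedule I (slow_down I S)"
    and "\<And>j. j \<in> tasks I \<Longrightarrow> speed (slow_down I S) j \<le> speed S j"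
    and "energy I (slow_down I S) \<le> energy I S"
    using wf unfolding energy_def
    by (auto intro!: sum_mono mult_left_mono powr_mono2 simp: wf_problem_def less_imp_le)
qed

lemma graham_schedule_valid:
  assumes wf: "wf_problem I" and "cp_feasible I x d" "cp_speeds I x s"
    and "graham_schedule I (proc_time I s) c t"
  shows "valid_schedule I \<lparr>speed = s, core = c, start = t\<rparr>"
proof -
  note props = cp_speeds_properties[OF assms(1-3)]
  have nonneg: "0 \<le> proc_time I s j" if "j \<in> tasks I" for j
    using wf props(1)[OF that] that by (simp add: proc_time_def wf_problem_def)
  obtain js where "topological_order I js" "list_schedule I (proc_time I s) js c t"
      "graham_rule I (proc_time I s) js c t"
    using assms(4) by (auto simp: graham_schedule_def)
  then interpret graham_run I "proc_time I s" js c t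
    using wf nonneg by unfold_locales
  have arcs: "arcs I \<subseteq> tasks I \<times> tasks I" using wf by (simp add: wf_problem_def)
  have "t j + proc_time I s j \<le> deadline I" if j: "j \<in> tasks I" for j
  proof -
    have "t j + proc_time I s j \<le> (\<Sum>k\<in>tasks I. proc_time I s k / real (cores I)) + d j"
    proof (rule completion_bound[OF _ _ j])
      show "proc_time I s k \<le> d k" if "k \<in> tasks I" for k
        using assms(2) props(3) that by (simp add: cp_feasible_def)
      show "d k + proc_time I s l \<le> d l" if "(k, l) \<in> arcs I" for k l
        proof -
        have "l \<in> tasks I" using that arcs by auto
        then show ?thesis using assms(2) props(3)[of l] that by (auto simp: cp_feasible_def)
      qed
    qed
    also have "(\<Sum>k\<in>tasks I. proc_time I s k / real (cores I)) = (\<Sum>k\<in>tasks I. x k / real (cores I))"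
      by (intro sum.cong) (simp_all add: props(3))
    finally show ?thesis using assms(2) j by (fastforce simp: cp_feasible_def)
  qed
  then show ?thesis using props(1) by (intro valid_scheduleI) auto
qed

theorem theorem3:
  fixes I :: "'a problem" and opt :: "'a schedule"
  assumes "wf_problem I"
    and "optimal I opt"
    and "\<forall>j\<in>tasks I. speed opt j \<le> smax I / 2"
  shows "(\<exists>S. apx_sched I S) \<and>
         (\<forall>S. apx_sched I S \<longrightarrow>
            valid_schedule I S \<and>
            (\<forall>j\<in>tasks I. speed S j \<le> smax I) \<and>
            energy I S \<le> 2 powr (alpha I - 1) * energy I opt)"
proof (intro conjI allI impI)
  have opt: "feasible I opt" using assms(2) by (simp add: optimal_def is_arg_min_def)
  note half = cp_feasible_half[OF assms(1) opt assms(3)]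
  obtain x d where xd: "cp_optimal I x d" using cp_optimal_exists[OF assms(1) half] by blast
  have "cp_speeds I x (\<lambda>j. if weight I j = 0 then smin I else weight I j / x j)"
    using assms(1) by (simp add: cp_speeds_def wf_problem_def)
  then show "\<exists>S. apx_sched I S"
    using xd graham_schedule_exists[OF assms(1)] unfolding apx_sched_def by blast
  fix S assume "apx_sched I S"
  then obtain x d s c t where opt_xd: "cp_optimal I x d" and s: "cp_speeds I x s"
    and gs: "graham_schedule I (proc_time I s) c t"
    and S: "S = slow_down I \<lparr>speed = s, core = c, start = t\<rparr>" (is "S = slow_down I ?S0")
    by (auto simp: apx_sched_def)
  have xd: "cp_feasible I x d"
    using opt_xd by (simp add: cp_optimal_def is_arg_min_linorder)
  have min: "cp_objective I x \<le> cp_objective I y" if "cp_feasible I y e" for y e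
    using opt_xd that by (auto simp: cp_optimal_def is_arg_min_linorder)
  note props = cp_speeds_properties[OF assms(1) xd s]
  note slow = slow_down_properties[OF assms(1) graham_schedule_valid[OF assms(1) xd s gs], folded S]
  show "valid_schedule I S" by (rule slow(1))
  show "\<forall>j\<in>tasks I. speed S j \<le> smax I"
    using slow(2) props(2) by fastforce
  have "energy I S \<le> energy I ?S0" by (rule slow(3))
  also have "\<dots> = cp_objective I x"
    unfolding energy_def cp_objective_def by (intro sum.cong) (simp_all add: props(4))
  also have "\<dots> \<le> 2 powr (alpha I - 1) * energy I opt"
    using min[OF half] cp_objective_half[OF assms(1)] opt by (simp add: feasible_def)
  finally show "energy I S \<le> 2 powr (alpha I - 1) * energy I opt" .
qed

end
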